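(* Let $\Pi=\prod_{s\in\mathcal S}\Pi_s\subseteq\Delta_{\mathcal A}^{\mathcal S}$ be a set of policies given by the Cartesian product of polytopes $\Pi_s\subseteq\Delta_{\mathcal A}$, $s\in\mathcal S$ (that is, $\pi\in\Pi$ iff $\pi(\cdot|s)\in\Pi_s$ for all $s$). Fix $\pi_0\in\Delta_{\mathcal A}^{\mathcal S}$ and let $$\hat\pi=\operatorname*{arg\,min}_{\pi\in\Pi}D_{\mathrm K}(\pi,\pi_0)$$ be the Kakade projection of $\pi_0$ onto $\Pi$. Then for every $\pi\in\Pi$ $$D_{\mathrm K}(\pi,\pi_0)\ \ge\ D_{\mathrm K}(\pi,\hat\pi)+D_{\mathrm K}(\hat\pi,\pi_0).$$ If moreover $\Pi_s=\Delta_{\mathcal A}\cap\mathcal L_s$ with affine spaces $\mathcal L_s\subseteq\mathbb R^{\mathcal A}$ for all $s\in\mathcal S$, then equality holds, i.e. $D_{\mathrm K}(\pi,\pi_0)=D_{\mathrm K}(\pi,\hat\pi)+D_{\mathrm K}(\hat\pi,\pi_0)$ for every $\pi\in\Pi$.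
   Context: $\mathcal S$ (states) and $\mathcal A$ (actions) are finite nonempty sets. For a finite set $X$, $\Delta_X$ is the simplex of probability vectors on $X$. A policy is an element $\pi\in\Delta_{\mathcal A}^{\mathcal S}$, with entries $\pi(a|s)$, where $\pi(\cdot|s)\in\Delta_{\mathcal A}$ for each $s$. Fixed data of the Markov decision process: a transition kernel $P(s'|s,a)$ (with $P(\cdot|s,a)\in\Delta_{\mathcal S}$), a discount factor $\gamma\in[0,1)$, and an initial distribution $\mu\in\Delta_{\mathcal S}$. Under policy $\pi$ the process is $S_0\sim\mu$, $A_t\sim\pi(\cdot|S_t)$, $S_{t+1}\sim P(\cdot|S_t,A_t)$, with law $\mathbb P^{\pi,\mu}$. The discounted state distribution is $d^\pi(s)=(1-\gamma)\sum_{t\in\mathbb N}\gamma^t\,\mathbb P^{\pi,\mu}(S_t=s)$ (sum starting at $t=0$). $D_{\mathrm{KL}}(p,q)=\sum_x p(x)\log\frac{p(x)}{q(x)}$ is the Kullback–Leibler divergence (with $0\log 0=0$, and value $+\infty$ if $p(x)>0=q(x)$ for some $x$). The Kakade divergence of two policies is $D_{\mathrm K}(\pi_1,\pi_2)=\sum_{s\in\mathcal S}d^{\pi_1}(s)\,D_{\mathrm{KL}}(\pi_1(\cdot|s),\pi_2(\cdot|s))$ (with $0\cdot\infty=0$). *)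

theory Defs
  imports "HOL-Probability.Probability"
begin

definition prob_simplex :: "(real ^ 'x::finite) set" where
  "prob_simplex = {p. (\<forall>x. 0 \<le> p $ x) \<and> (\<Sum>x\<in>UNIV. p $ x) = 1}"

text \<open>The random choice described by a probability vector; meaningful for
  \<open>p \<in> prob_simplex\<close> only.\<close>

definition vec_pmf :: "real ^ 'x::finite \<Rightarrow> 'x pmf" where
  "vec_pmf p = embed_pmf (\<lambda>x. p $ x)"

text \<open>A policy is a function \<open>\<pi> :: 's \<Rightarrow> real ^ 'a\<close> with \<open>\<pi> s \<in> prob_simplex\<close> for all \<open>s\<close>, and
  \<open>\<pi> s $ a\<close> is \<open>\<pi>(a|s)\<close>. The transition kernel \<open>P s a\<close> and the initial distribution \<open>\<mu>\<close>
  are probability mass functions on the finite type of states.\<close>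

definition policies :: "('s \<Rightarrow> real ^ 'a::finite) set" where
  "policies = {\<pi>. \<forall>s. \<pi> s \<in> prob_simplex}"

definition product_policies :: "('s \<Rightarrow> (real ^ 'a::finite) set) \<Rightarrow> ('s \<Rightarrow> real ^ 'a) set" where
  "product_policies Q = {\<pi>. \<forall>s. \<pi> s \<in> Q s}"

text \<open>The conditional law of \<open>(S\<^sub>t, A\<^sub>t)\<close> given the history
  \<open>\<omega> i = (S\<^sub>i, A\<^sub>i)\<close>, \<open>i < t\<close>.\<close>

fun mdp_step :: "'s pmf \<Rightarrow> ('s \<Rightarrow> 'a \<Rightarrow> 's pmf) \<Rightarrow> ('s \<Rightarrow> real ^ 'a::finite)
    \<Rightarrow> nat \<Rightarrow> (nat \<Rightarrow> 's \<times> 'a) \<Rightarrow> ('s \<times> 'a) pmf" where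
  "mdp_step \<mu> P \<pi> 0 \<omega> =
     bind_pmf \<mu> (\<lambda>s. map_pmf (Pair s) (vec_pmf (\<pi> s)))"
| "mdp_step \<mu> P \<pi> (Suc t) \<omega> =
     bind_pmf (P (fst (\<omega> t)) (snd (\<omega> t))) (\<lambda>s. map_pmf (Pair s) (vec_pmf (\<pi> s)))"

text \<open>The law of the process \<open>(S\<^sub>t, A\<^sub>t)\<close>, \<open>t \<in> \<nat>\<close>, on the space of trajectories: the measure
  given by the Ionescu-Tulcea theorem for the kernels above.\<close>

definition mdp_law :: "'s pmf \<Rightarrow> ('s \<Rightarrow> 'a \<Rightarrow> 's pmf) \<Rightarrow> ('s \<Rightarrow> real ^ 'a::finite)
    \<Rightarrow> (nat \<Rightarrow> 's \<times> 'a) measure" where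
  "mdp_law \<mu> P \<pi> =
     projective_family.lim UNIV
       (Ionescu_Tulcea.CI (\<lambda>t \<omega>. measure_pmf (mdp_step \<mu> P \<pi> t \<omega>)) (\<lambda>_. count_space UNIV))
       (\<lambda>_. count_space UNIV)"

definition state_dist :: "real \<Rightarrow> 's pmf \<Rightarrow> ('s \<Rightarrow> 'a \<Rightarrow> 's pmf) \<Rightarrow> ('s \<Rightarrow> real ^ 'a::finite)
    \<Rightarrow> 's \<Rightarrow> real" where
  "state_dist \<gamma> \<mu> P \<pi> s =
     (1 - \<gamma>) * (\<Sum>t. \<gamma> ^ t * measure (mdp_law \<mu> P \<pi>) {\<omega>. fst (\<omega> t) = s})"

text \<open>\<open>KL_divergence\<close> from the library is real-valued, whereas the value \<open>\<infinity>\<close> is needed here.\<close>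

definition kl_div :: "real ^ 'x::finite \<Rightarrow> real ^ 'x \<Rightarrow> ereal" where
  "kl_div p q = (\<Sum>x\<in>UNIV.
     if p $ x = 0 then 0
     else if q $ x = 0 then \<infinity>
     else ereal (p $ x * ln (p $ x / q $ x)))"

text \<open>Note that \<open>0 * \<infinity> = 0\<close> in \<^typ>\<open>ereal\<close>.\<close>

definition kakade_div :: "real \<Rightarrow> 's::finite pmf \<Rightarrow> ('s \<Rightarrow> 'a \<Rightarrow> 's pmf)
    \<Rightarrow> ('s \<Rightarrow> real ^ 'a::finite) \<Rightarrow> ('s \<Rightarrow> real ^ 'a) \<Rightarrow> ereal" where
  "kakade_div \<gamma> \<mu> P \<pi>\<^sub>1 \<pi>\<^sub>2 =
     (\<Sum>s\<in>UNIV. ereal (state_dist \<gamma> \<mu> P \<pi>\<^sub>1 s) * kl_div (\<pi>\<^sub>1 s) (\<pi>\<^sub>2 s))"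

text \<open>\<open>\<pi>'\<close> is a Kakade projection of \<open>\<pi>\<^sub>0\<close> onto \<open>Q\<close>. Minimisers need not be unique,
  since \<open>\<pi>' s\<close> does not matter for states \<open>s\<close> that are never visited under \<open>\<pi>'\<close>.\<close>

definition is_kakade_projection :: "real \<Rightarrow> 's::finite pmf \<Rightarrow> ('s \<Rightarrow> 'a \<Rightarrow> 's pmf)
    \<Rightarrow> ('s \<Rightarrow> real ^ 'a::finite) set \<Rightarrow> ('s \<Rightarrow> real ^ 'a) \<Rightarrow> ('s \<Rightarrow> real ^ 'a) \<Rightarrow> bool" where
  "is_kakade_projection \<gamma> \<mu> P Q \<pi>\<^sub>0 \<pi>' \<longleftrightarrow>
     is_arg_min (\<lambda>\<pi>. kakade_div \<gamma> \<mu> P \<pi> \<pi>\<^sub>0) (\<lambda>\<pi>. \<pi> \<in> Q) \<pi>'"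

end

theory Submission
  imports Defs
begin

text \<open>
  Write \<open>d\<^sup>\<pi>\<close> for the discounted state distribution and \<open>\<eta>\<^sup>\<pi>(s,a) = d\<^sup>\<pi>(s) \<pi>(a|s)\<close> for the
  occupancy measure of a policy. The Kakade divergence is not convex in the policy, but it is convex
  in \<open>\<eta>\<close>, being a conditional relative entropy, and the set of occupancy measures of a product of
  convex sets of policies is convex: \<open>d\<^sup>\<pi>\<close> is the only solution of the Bellman flow equation, which
  is linear in \<open>\<eta>\<close>, so \<open>(1-l) \<eta>\<^sup>\<pi>\<^sup>' + l \<eta>\<^sup>\<pi>\<close> is the occupancy measure of its own conditional policy
  \<open>\<rho>\<^sub>l\<close>, and in every state \<open>\<rho>\<^sub>l\<close> is a convex combination of \<open>\<pi>'\<close> and \<open>\<pi>\<close>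
  (\<open>convex_mixture\<close>). The information-geometric argument for relative entropies then applies.

  The compensation identity (\<open>weighted_kl_compensation\<close>) reads
  \<open>D(\<rho>\<^sub>l,\<pi>\<^sub>0) + (1-l) D(\<pi>',\<rho>\<^sub>l) + l D(\<pi>,\<rho>\<^sub>l) = (1-l) D(\<pi>',\<pi>\<^sub>0) + l D(\<pi>,\<pi>\<^sub>0)\<close>.
  If \<open>\<pi>'\<close> is a minimiser and \<open>D(\<pi>,\<pi>\<^sub>0)\<close> is finite, then \<open>D(\<rho>\<^sub>l,\<pi>\<^sub>0) \<ge> D(\<pi>',\<pi>\<^sub>0)\<close>;
  dropping \<open>D(\<pi>',\<rho>\<^sub>l) \<ge> 0\<close> and dividing by \<open>l\<close> gives
  \<open>D(\<pi>,\<rho>\<^sub>l) \<le> D(\<pi>,\<pi>\<^sub>0) - D(\<pi>',\<pi>\<^sub>0)\<close> for all \<open>0 < l < 1\<close>. As \<open>l\<close> tends to 0, \<open>\<rho>\<^sub>l\<close> tends to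
  \<open>\<pi>'\<close> in the states visited under \<open>\<pi>'\<close>, and the inequality follows.

  Minimisers need not be unique, as \<open>\<pi>'\<close> is arbitrary in the states that it never visits. This does no
  harm: the uniform bound on \<open>D(\<pi>,\<rho>\<^sub>l)\<close> prevents \<open>\<pi>'\<close> from excluding an action of \<open>\<pi>\<close> in a state
  that both visit, for otherwise \<open>D(\<pi>,\<rho>\<^sub>l)\<close> would blow up. Hence \<open>\<pi>'\<close> can follow every trajectory of
  \<open>\<pi>\<close>, and all states visited under \<open>\<pi>\<close> are visited under \<open>\<pi>'\<close>
  (\<open>visited_if_actions_dominated\<close>).

  In the affine case, the same support inclusion allows the segment from \<open>\<pi>\<close> to \<open>\<pi>'\<close> to be prolonged a
  little beyond \<open>\<pi>'\<close> to some \<open>\<rho>\<close> in the product set. The inequality for \<open>\<rho>\<close>, and the compensation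
  identity for \<open>\<pi>'\<close> as a mixture of \<open>\<rho>\<close> and \<open>\<pi>\<close>, give the reverse inequality for \<open>\<pi>\<close>. When
  \<open>D(\<pi>,\<pi>\<^sub>0)\<close> is infinite, so is the right-hand side, because finiteness of the divergence is
  transitive (\<open>dominated_trans\<close>).
\<close>

section \<open>State marginals of the trajectory law\<close>

lemma pmf_vec_pmf:
  assumes "p \<in> prob_simplex"
  shows "pmf (vec_pmf p) x = p $ x"
proof -
  have "(\<integral>\<^sup>+ x. ennreal (p $ x) \<partial>count_space UNIV) = ennreal (\<Sum>x\<in>UNIV. p $ x)"
    using assms by (simp add: nn_integral_count_space_finite prob_simplex_def sum_ennreal)
  then show ?thesis
    using assms unfolding vec_pmf_def by (intro pmf_embed_pmf) (auto simp: prob_simplex_def)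
qed

text \<open>The law of \<open>S\<^sub>t\<close>, described without trajectories. Only this marginal enters
  \<^const>\<open>state_dist\<close>.\<close>
primrec state_pmf ::
  "'s pmf \<Rightarrow> ('s \<Rightarrow> 'a \<Rightarrow> 's pmf) \<Rightarrow> ('s \<Rightarrow> real ^ 'a::finite) \<Rightarrow> nat \<Rightarrow> 's pmf" where
  "state_pmf \<mu> P \<pi> 0 = \<mu>"
| "state_pmf \<mu> P \<pi> (Suc t) = bind_pmf (state_pmf \<mu> P \<pi> t) (\<lambda>s. bind_pmf (vec_pmf (\<pi> s)) (P s))"

abbreviation state_action_pmf where
  "state_action_pmf \<pi> p \<equiv> bind_pmf p (\<lambda>s. map_pmf (Pair s) (vec_pmf (\<pi> s)))"

lemma measurable_mdp_step:
  fixes \<mu> :: "'s::finite pmf" and P :: "'s \<Rightarrow> 'a::finite \<Rightarrow> 's pmf"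
  shows "(\<lambda>\<omega>. measure_pmf (mdp_step \<mu> P \<pi> t \<omega>))
     \<in> measurable (PiM {0..<t} (\<lambda>_. count_space UNIV)) (subprob_algebra (count_space UNIV))"
proof (cases t)
  case 0
  then show ?thesis
    by (simp add: space_subprob_algebra prob_space_imp_subprob_space prob_space_measure_pmf)
next
  case (Suc k)
  have "(\<lambda>\<omega>. (\<lambda>z. measure_pmf (state_action_pmf \<pi> (P (fst z) (snd z)))) (\<omega> k))
     \<in> measurable (PiM {0..<t} (\<lambda>_. count_space UNIV)) (subprob_algebra (count_space UNIV))"
    by (rule measurable_compose[OF measurable_component_singleton])
       (auto simp: Suc space_subprob_algebra prob_space_imp_subprob_space prob_space_measure_pmf)
  then show ?thesis
    by (simp add: Suc)
qed

lemma mdp_Ionescu_Tulcea: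
  fixes \<mu> :: "'s::finite pmf" and P :: "'s \<Rightarrow> 'a::finite \<Rightarrow> 's pmf"
  shows "Ionescu_Tulcea (\<lambda>t \<omega>. measure_pmf (mdp_step \<mu> P \<pi> t \<omega>)) (\<lambda>_. count_space UNIV)"
  by unfold_locales (use measurable_mdp_step prob_space_measure_pmf in \<open>auto simp: prob_space_measure_pmf\<close>)

context
  fixes \<mu> :: "'s::finite pmf" and P :: "'s \<Rightarrow> 'a::finite \<Rightarrow> 's pmf" and \<pi> :: "'s \<Rightarrow> real ^ 'a"
begin

interpretation IT: Ionescu_Tulcea "\<lambda>t \<omega>. measure_pmf (mdp_step \<mu> P \<pi> t \<omega>)"
  "\<lambda>_. count_space (UNIV :: ('s \<times> 'a) set)"
  by (rule mdp_Ionescu_Tulcea)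

text \<open>The measure \<open>IT.C 0 (Suc t)\<close> is the joint law of the first \<open>t + 1\<close> state-action pairs. Its
  last kernel looks only at the pair before, hence integrating out that kernel turns a function of
  pair \<open>t + 1\<close> into a function of pair \<open>t\<close>, and induction over all integrands at once applies.\<close>
lemma nn_integral_mdp_history:
  "(\<integral>\<^sup>+\<omega>. f (\<omega> t) \<partial>IT.C 0 (Suc t) (\<lambda>_. undefined)) =
   (\<integral>\<^sup>+z. f z \<partial>measure_pmf (state_action_pmf \<pi> (state_pmf \<mu> P \<pi> t)))"
proof (induction t arbitrary: f)
  have one_step: "(\<integral>\<^sup>+\<omega>. f (\<omega> t) \<partial>IT.C 0 (Suc t) (\<lambda>_. undefined)) =
     (\<integral>\<^sup>+\<omega>. (\<integral>\<^sup>+z. f z \<partial>measure_pmf (mdp_step \<mu> P \<pi> t \<omega>)) \<partial>IT.C 0 t (\<lambda>_. undefined))" for t f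
  proof -
    have m: "(\<lambda>\<omega>. f (\<omega> t)) \<in> borel_measurable (PiM {0..<Suc t} (\<lambda>_. count_space UNIV))"
      by (rule measurable_compose[OF measurable_component_singleton]) auto
    have "(\<integral>\<^sup>+\<omega>. f (\<omega> t) \<partial>IT.C 0 (Suc t) (\<lambda>_. undefined)) =
      (\<integral>\<^sup>+\<omega>. (\<integral>\<^sup>+\<omega>'. f (\<omega>' t) \<partial>IT.eP t \<omega>) \<partial>IT.C 0 t (\<lambda>_. undefined))"
      using m IT.measurable_eP[of t]
      by (simp, subst nn_integral_bind[where B = "PiM {0..<Suc t} (\<lambda>_. count_space UNIV)"])
         (auto simp: measurable_cong_sets[OF IT.sets_C])
    also have "\<dots> = (\<integral>\<^sup>+\<omega>. (\<integral>\<^sup>+z. f z \<partial>measure_pmf (mdp_step \<mu> P \<pi> t \<omega>)) \<partial>IT.C 0 t (\<lambda>_. undefined))"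
      using m by (intro nn_integral_cong) (simp add: IT.space_C IT.nn_integral_eP)
    finally show ?thesis .
  qed
  {
    case 0
    show ?case
      unfolding one_step by (simp add: nn_integral_return)
  next
    case (Suc t)
    have "(\<integral>\<^sup>+\<omega>. f (\<omega> (Suc t)) \<partial>IT.C 0 (Suc (Suc t)) (\<lambda>_. undefined)) =
      (\<integral>\<^sup>+\<omega>. (\<integral>\<^sup>+z. f z \<partial>measure_pmf (state_action_pmf \<pi> (P (fst (\<omega> t)) (snd (\<omega> t)))))
         \<partial>IT.C 0 (Suc t) (\<lambda>_. undefined))"
      unfolding one_step[of "Suc t"] by simp
    also have "\<dots> = (\<integral>\<^sup>+y. (\<integral>\<^sup>+z. f z \<partial>measure_pmf (state_action_pmf \<pi> (P (fst y) (snd y))))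
         \<partial>measure_pmf (state_action_pmf \<pi> (state_pmf \<mu> P \<pi> t)))"
      by (rule Suc.IH)
    also have "\<dots> = (\<integral>\<^sup>+z. f z \<partial>measure_pmf (state_action_pmf \<pi> (state_pmf \<mu> P \<pi> (Suc t))))"
      by (simp add: nn_integral_bind_pmf)
    finally show ?case .
  }
qed

lemma measure_mdp_law_state:
  "measure (mdp_law \<mu> P \<pi>) {\<omega>. fst (\<omega> t) = s} = pmf (state_pmf \<mu> P \<pi> t) s"
proof -
  let ?M = "\<lambda>_::nat. count_space (UNIV :: ('s \<times> 'a) set)"
  let ?X = "{x \<in> space (PiM {0..<Suc t} ?M). fst (x t) = s}"
  have m: "(\<lambda>\<omega>. indicator {z. fst z = s} (\<omega> t) :: ennreal) \<in> borel_measurable (PiM {0..<Suc t} ?M)"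
    by (rule measurable_compose[OF measurable_component_singleton]) auto
  have X: "?X \<in> sets (PiM {0..<Suc t} ?M)"
  proof -
    have "(\<lambda>x. x t) \<in> measurable (PiM {0..<Suc t} ?M) (count_space UNIV)"
      by (rule measurable_component_singleton) auto
    from measurable_sets[OF this, of "{z. fst z = s}"] show ?thesis
      by (simp add: vimage_def Int_def conj_commute)
  qed
  have up: "IT.up_to {0..<Suc t} = Suc t"
    using IT.up_to_less[of "{0..<Suc t}" t] by (intro antisym) (simp_all add: IT.up_to_iff_Ico)
  have emb: "{\<omega>. fst (\<omega> t) = s} = IT.PF.emb UNIV {0..<Suc t} ?X"
    by (auto simp: prod_emb_def space_PiM)
  have "emeasure (mdp_law \<mu> P \<pi>) {\<omega>. fst (\<omega> t) = s} = emeasure (IT.CI {0..<Suc t}) ?X"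
    unfolding mdp_law_def emb using X by (intro IT.lim) auto
  also have "\<dots> = emeasure (IT.C 0 (Suc t) (\<lambda>_. undefined)) ?X"
    using IT.distr_C[of "Suc t" "Suc t" "\<lambda>_. undefined" 0] by (simp add: IT.CI_def up del: IT.C.simps)
  also have "\<dots> = (\<integral>\<^sup>+\<omega>. indicator ?X \<omega> \<partial>IT.C 0 (Suc t) (\<lambda>_. undefined))"
    using X by (simp add: IT.sets_C del: IT.C.simps)
  also have "\<dots> = (\<integral>\<^sup>+\<omega>. indicator {z. fst z = s} (\<omega> t) \<partial>IT.C 0 (Suc t) (\<lambda>_. undefined))"
    by (intro nn_integral_cong) (auto simp: IT.space_C indicator_def simp del: IT.C.simps)
  also have "\<dots> = (\<integral>\<^sup>+z. indicator {z. fst z = s} z \<partial>measure_pmf (state_action_pmf \<pi> (state_pmf \<mu> P \<pi> t)))"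
    by (rule nn_integral_mdp_history)
  also have "\<dots> = (\<integral>\<^sup>+r. indicator {s} r \<partial>measure_pmf (state_pmf \<mu> P \<pi> t))"
    by (auto simp: nn_integral_bind_pmf indicator_def intro!: nn_integral_cong)
  also have "\<dots> = ennreal (pmf (state_pmf \<mu> P \<pi> t) s)"
    by (simp add: emeasure_pmf_single)
  finally show ?thesis
    by (simp add: measure_def)
qed

end

lemma pmf_state_pmf_Suc:
  fixes \<mu> :: "'s::finite pmf" and P :: "'s \<Rightarrow> 'a::finite \<Rightarrow> 's pmf"
  assumes "\<pi> \<in> policies"
  shows "pmf (state_pmf \<mu> P \<pi> (Suc t)) s' =
    (\<Sum>s\<in>UNIV. \<Sum>a\<in>UNIV. pmf (state_pmf \<mu> P \<pi> t) s * \<pi> s $ a * pmf (P s a) s')"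
proof -
  have [simp]: "pmf (vec_pmf (\<pi> s)) a = \<pi> s $ a" for s a
    using assms by (simp add: policies_def pmf_vec_pmf)
  show ?thesis
    by (simp add: pmf_bind integral_measure_pmf_real[of UNIV] sum_distrib_left sum_distrib_right
        mult_ac)
qed

section \<open>The Bellman flow equation\<close>

locale discounted_mdp =
  fixes \<gamma> :: real and \<mu> :: "'s::finite pmf" and P :: "'s \<Rightarrow> 'a::finite \<Rightarrow> 's pmf"
  assumes discount_nonneg: "0 \<le> \<gamma>" and discount_less_1: "\<gamma> < 1"
begin

abbreviation visit :: "('s \<Rightarrow> real ^ 'a) \<Rightarrow> 's \<Rightarrow> real" where
  "visit \<equiv> state_dist \<gamma> \<mu> P"

text \<open>The balance equation for discounted visits: a visit is either at time 0 or comes from a visit one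
  step earlier. The state distribution \<open>d\<close> and the policy \<open>\<pi>\<close> enter only through \<open>d s * \<pi> s $ a\<close>,
  so the equation is linear in the occupancy measure.\<close>
definition bellman_flow :: "('s \<Rightarrow> real) \<Rightarrow> ('s \<Rightarrow> real ^ 'a) \<Rightarrow> bool" where
  "bellman_flow d \<pi> \<longleftrightarrow> (\<forall>s'. d s' =
     (1 - \<gamma>) * pmf \<mu> s' + \<gamma> * (\<Sum>s\<in>UNIV. \<Sum>a\<in>UNIV. d s * \<pi> s $ a * pmf (P s a) s'))"

lemma bellman_flowD:
  "bellman_flow d \<pi> \<Longrightarrow> d s' =
     (1 - \<gamma>) * pmf \<mu> s' + \<gamma> * (\<Sum>s\<in>UNIV. \<Sum>a\<in>UNIV. d s * \<pi> s $ a * pmf (P s a) s')"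
  unfolding bellman_flow_def by blast

lemma summable_discounted_pmf: "summable (\<lambda>t. \<gamma> ^ t * pmf (state_pmf \<mu> P \<pi> t) s)"
proof (rule summable_comparison_test')
  show "summable (\<lambda>t. \<gamma> ^ t)"
    using discount_nonneg discount_less_1 by (simp add: summable_geometric)
  show "norm (\<gamma> ^ t * pmf (state_pmf \<mu> P \<pi> t) s) \<le> \<gamma> ^ t" if "0 \<le> t" for t
    using discount_nonneg by (simp add: abs_mult pmf_le_1 mult_left_le)
qed

lemma state_dist_eq_suminf:
  "visit \<pi> s = (1 - \<gamma>) * (\<Sum>t. \<gamma> ^ t * pmf (state_pmf \<mu> P \<pi> t) s)"
  by (simp add: state_dist_def measure_mdp_law_state)

lemma state_dist_nonneg: "0 \<le> visit \<pi> s"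
  unfolding state_dist_eq_suminf
  using discount_nonneg discount_less_1
  by (intro mult_nonneg_nonneg suminf_nonneg summable_discounted_pmf) auto

lemma bellman_flow_state_dist:
  assumes "\<pi> \<in> policies"
  shows "bellman_flow (visit \<pi>) \<pi>"
  unfolding bellman_flow_def
proof
  fix s'
  let ?p = "\<lambda>t s. pmf (state_pmf \<mu> P \<pi> t) s"
  have sums: "(\<lambda>t. \<gamma> ^ t * ?p t s) sums (\<Sum>t. \<gamma> ^ t * ?p t s)" for s
    using summable_discounted_pmf by (rule summable_sums)
  have "(\<lambda>t. \<gamma> * (\<Sum>s\<in>UNIV. \<Sum>a\<in>UNIV. (\<gamma> ^ t * ?p t s) * \<pi> s $ a * pmf (P s a) s')) sums
      (\<gamma> * (\<Sum>s\<in>UNIV. \<Sum>a\<in>UNIV. (\<Sum>t. \<gamma> ^ t * ?p t s) * \<pi> s $ a * pmf (P s a) s'))"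
    by (intro sums_mult sums_sum sums_mult2 sums)
  moreover have "\<gamma> ^ Suc t * ?p (Suc t) s' =
      \<gamma> * (\<Sum>s\<in>UNIV. \<Sum>a\<in>UNIV. (\<gamma> ^ t * ?p t s) * \<pi> s $ a * pmf (P s a) s')" for t
    unfolding pmf_state_pmf_Suc[OF assms] by (simp add: sum_distrib_left mult_ac)
  ultimately have "(\<lambda>t. \<gamma> ^ Suc t * ?p (Suc t) s') sums
      (\<gamma> * (\<Sum>s\<in>UNIV. \<Sum>a\<in>UNIV. (\<Sum>t. \<gamma> ^ t * ?p t s) * \<pi> s $ a * pmf (P s a) s'))"
    by (simp only:)
  then have "(\<Sum>t. \<gamma> ^ t * ?p t s') = pmf \<mu> s' +
      \<gamma> * (\<Sum>s\<in>UNIV. \<Sum>a\<in>UNIV. (\<Sum>t. \<gamma> ^ t * ?p t s) * \<pi> s $ a * pmf (P s a) s')"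
    using suminf_split_head[OF summable_discounted_pmf, of \<pi> s'] by (simp add: sums_iff)
  then show "visit \<pi> s' = (1 - \<gamma>) * pmf \<mu> s' +
      \<gamma> * (\<Sum>s\<in>UNIV. \<Sum>a\<in>UNIV. visit \<pi> s * \<pi> s $ a * pmf (P s a) s')"
    unfolding state_dist_eq_suminf by (simp add: distrib_left sum_distrib_left mult_ac)
qed

lemma policy_nonneg: "\<pi> \<in> policies \<Longrightarrow> 0 \<le> \<pi> s $ a"
  by (simp add: policies_def prob_simplex_def)

lemma policy_sum: "\<pi> \<in> policies \<Longrightarrow> (\<Sum>a\<in>UNIV. \<pi> s $ a) = 1"
  by (simp add: policies_def prob_simplex_def)

text \<open>One step of the process preserves total mass.\<close>
lemma sum_kernel:
  assumes "\<pi> \<in> policies"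
  shows "(\<Sum>s'\<in>UNIV. \<Sum>s\<in>UNIV. \<Sum>a\<in>UNIV. f s * \<pi> s $ a * pmf (P s a) s') = (\<Sum>s\<in>UNIV. f s)"
proof -
  have "(\<Sum>s'\<in>UNIV. pmf (P s a) s') = 1" for s a
    by (rule sum_pmf_eq_1) auto
  then have "(\<Sum>s\<in>UNIV. \<Sum>a\<in>UNIV. \<Sum>s'\<in>UNIV. f s * \<pi> s $ a * pmf (P s a) s') = (\<Sum>s\<in>UNIV. f s)"
    by (simp add: sum_distrib_left[symmetric] policy_sum[OF assms])
  moreover have "(\<Sum>s'\<in>UNIV. \<Sum>s\<in>UNIV. \<Sum>a\<in>UNIV. f s * \<pi> s $ a * pmf (P s a) s') =
     (\<Sum>s\<in>UNIV. \<Sum>a\<in>UNIV. \<Sum>s'\<in>UNIV. f s * \<pi> s $ a * pmf (P s a) s')"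
    by (subst sum.swap) (intro sum.cong refl sum.swap)
  ultimately show ?thesis by simp
qed

text \<open>Summed over all states, the hypothesis says that the total mass is at most \<open>\<gamma>\<close> times itself.
  This gives the uniqueness of the Bellman flow and the inclusion of visited states alike.\<close>
lemma discounted_subinvariant_eq_0:
  assumes "\<pi> \<in> policies" and nonneg: "\<And>s. 0 \<le> \<delta> s"
    and le: "\<And>s'. \<delta> s' \<le> \<gamma> * (\<Sum>s\<in>UNIV. \<Sum>a\<in>UNIV. \<delta> s * \<pi> s $ a * pmf (P s a) s')"
  shows "\<delta> s = 0"
proof -
  have "(\<Sum>s'\<in>UNIV. \<delta> s') \<le>
      (\<Sum>s'\<in>UNIV. \<gamma> * (\<Sum>s\<in>UNIV. \<Sum>a\<in>UNIV. \<delta> s * \<pi> s $ a * pmf (P s a) s'))"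
    by (intro sum_mono le)
  also have "\<dots> = \<gamma> * (\<Sum>s\<in>UNIV. \<delta> s)"
    by (simp only: sum_distrib_left[symmetric] sum_kernel[OF assms(1)])
  finally have "(1 - \<gamma>) * (\<Sum>s\<in>UNIV. \<delta> s) \<le> 0"
    by (simp add: left_diff_distrib)
  then have "(\<Sum>s\<in>UNIV. \<delta> s) \<le> 0"
    using discount_less_1 by (simp add: mult_le_0_iff)
  then have "(\<Sum>s\<in>UNIV. \<delta> s) = 0"
    by (intro antisym sum_nonneg nonneg)
  then show ?thesis
    using nonneg by (simp add: sum_nonneg_eq_0_iff)
qed

lemma bellman_flow_unique:
  assumes "\<pi> \<in> policies" "bellman_flow d \<pi>" "bellman_flow e \<pi>"
  shows "d = e"
proof -
  define \<delta> where "\<delta> s = \<bar>d s - e s\<bar>" for s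
  let ?K = "\<lambda>d s'. \<Sum>s\<in>UNIV. \<Sum>a\<in>UNIV. d s * \<pi> s $ a * pmf (P s a) s'"
  have diff: "d s' - e s' = \<gamma> * ?K (\<lambda>s. d s - e s) s'" for s'
  proof -
    have "d s' = (1 - \<gamma>) * pmf \<mu> s' + \<gamma> * ?K d s'" "e s' = (1 - \<gamma>) * pmf \<mu> s' + \<gamma> * ?K e s'"
      using assms(2,3) by (blast dest: bellman_flowD)+
    then have "d s' - e s' = \<gamma> * ?K d s' - \<gamma> * ?K e s'"
      by linarith
    also have "\<dots> = \<gamma> * ?K (\<lambda>s. d s - e s) s'"
      by (simp only: left_diff_distrib right_diff_distrib sum_subtractf)
    finally show ?thesis .
  qed
  have "\<delta> s' = \<gamma> * \<bar>?K (\<lambda>s. d s - e s) s'\<bar>" for s'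
    using discount_nonneg unfolding \<delta>_def diff[of s'] abs_mult by simp
  moreover have "\<bar>\<Sum>s\<in>UNIV. \<Sum>a\<in>UNIV. (d s - e s) * \<pi> s $ a * pmf (P s a) s'\<bar>
      \<le> (\<Sum>s\<in>UNIV. \<Sum>a\<in>UNIV. \<bar>(d s - e s) * \<pi> s $ a * pmf (P s a) s'\<bar>)" for s'
    by (intro order_trans[OF sum_abs] sum_mono sum_abs)
  moreover have "\<bar>(d s - e s) * \<pi> s $ a * pmf (P s a) s'\<bar> = \<delta> s * \<pi> s $ a * pmf (P s a) s'" for s a s'
    using policy_nonneg[OF assms(1)] by (simp add: \<delta>_def abs_mult)
  ultimately have "\<delta> s' \<le> \<gamma> * (\<Sum>s\<in>UNIV. \<Sum>a\<in>UNIV. \<delta> s * \<pi> s $ a * pmf (P s a) s')" for s'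
    using discount_nonneg by (simp add: mult_left_mono)
  then have "\<delta> s = 0" for s
    by (rule discounted_subinvariant_eq_0[OF assms(1), rotated]) (simp add: \<delta>_def)
  then show ?thesis
    by (auto simp: \<delta>_def)
qed

text \<open>The weights may be negative; this is used to prolong a segment of occupancy measures beyond an
  end point.\<close>
lemma bellman_flow_affine_combination:
  assumes "bellman_flow d\<^sub>1 \<pi>\<^sub>1" "bellman_flow d\<^sub>2 \<pi>\<^sub>2" "u + v = 1"
    and "\<And>s. d s = u * d\<^sub>1 s + v * d\<^sub>2 s"
    and "\<And>s a. d s * \<pi> s $ a = u * (d\<^sub>1 s * \<pi>\<^sub>1 s $ a) + v * (d\<^sub>2 s * \<pi>\<^sub>2 s $ a)"
  shows "bellman_flow d \<pi>"
  unfolding bellman_flow_def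
proof
  fix s'
  let ?K = "\<lambda>d \<pi>. \<Sum>s\<in>UNIV. \<Sum>a\<in>UNIV. d s * \<pi> s $ a * pmf (P s a) s'"
  have K: "?K d \<pi> = u * ?K d\<^sub>1 \<pi>\<^sub>1 + v * ?K d\<^sub>2 \<pi>\<^sub>2"
    unfolding assms(5) distrib_right sum.distrib sum_distrib_left mult.assoc ..
  have eq: "d\<^sub>1 s' = (1 - \<gamma>) * pmf \<mu> s' + \<gamma> * ?K d\<^sub>1 \<pi>\<^sub>1"
    "d\<^sub>2 s' = (1 - \<gamma>) * pmf \<mu> s' + \<gamma> * ?K d\<^sub>2 \<pi>\<^sub>2"
    using assms(1,2) by (blast dest: bellman_flowD)+
  have "d s' = u * d\<^sub>1 s' + v * d\<^sub>2 s'"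
    by (rule assms(4))
  also have "\<dots> = u * ((1 - \<gamma>) * pmf \<mu> s' + \<gamma> * ?K d\<^sub>1 \<pi>\<^sub>1) + v * ((1 - \<gamma>) * pmf \<mu> s' + \<gamma> * ?K d\<^sub>2 \<pi>\<^sub>2)"
    by (simp only: eq[symmetric])
  also have "\<dots> = (u + v) * ((1 - \<gamma>) * pmf \<mu> s') + \<gamma> * ?K d \<pi>"
    unfolding K by (simp only: algebra_simps)
  finally show "d s' = (1 - \<gamma>) * pmf \<mu> s' + \<gamma> * ?K d \<pi>"
    by (simp add: assms(3))
qed

text \<open>Every trajectory of \<open>\<pi>\<close> that has positive probability can be followed by \<open>\<rho>\<close>, since in states
  visited under both policies \<open>\<rho>\<close> admits all actions of \<open>\<pi>\<close>. In terms of the flow equation: the part of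
  \<^term>\<open>visit \<pi>\<close> that lies in the states not visited under \<open>\<rho>\<close> receives nothing from outside
  these states, so it is subinvariant and vanishes.\<close>
lemma visited_if_actions_dominated:
  assumes pol: "\<pi> \<in> policies" "\<rho> \<in> policies"
    and dom: "\<And>s a. 0 < visit \<pi> s \<Longrightarrow> 0 < visit \<rho> s \<Longrightarrow> 0 < \<pi> s $ a \<Longrightarrow> 0 < \<rho> s $ a"
    and s: "0 < visit \<pi> s"
  shows "0 < visit \<rho> s"
proof -
  define A where "A = {s. visit \<rho> s = 0}"
  define \<delta> where "\<delta> s = (if s \<in> A then visit \<pi> s else 0)" for s
  note nn = state_dist_nonneg policy_nonneg[OF pol(1)] policy_nonneg[OF pol(2)]
    discount_nonneg
  have \<delta>_nonneg: "0 \<le> \<delta> s" for s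
    by (simp add: \<delta>_def nn)
  have le: "\<delta> s' \<le> \<gamma> * (\<Sum>s\<in>UNIV. \<Sum>a\<in>UNIV. \<delta> s * \<pi> s $ a * pmf (P s a) s')" for s'
  proof (cases "s' \<in> A")
    case False
    then show ?thesis
      unfolding \<delta>_def[of s'] using \<delta>_nonneg nn by (auto intro!: mult_nonneg_nonneg sum_nonneg)
  next
    case True
    let ?K = "\<Sum>s\<in>UNIV. \<Sum>a\<in>UNIV. visit \<rho> s * \<rho> s $ a * pmf (P s a) s'"
    \<comment> \<open>A state missed by \<open>\<rho>\<close> has no initial mass and no inflow under \<open>\<rho>\<close>.\<close>
    have "0 = (1 - \<gamma>) * pmf \<mu> s' + \<gamma> * ?K"
      using bellman_flowD[OF bellman_flow_state_dist[OF pol(2)], of s'] True by (simp add: A_def)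
    moreover have "0 \<le> (1 - \<gamma>) * pmf \<mu> s'" "0 \<le> \<gamma> * ?K"
      using nn discount_less_1 by (auto intro!: mult_nonneg_nonneg sum_nonneg)
    ultimately have 0: "(1 - \<gamma>) * pmf \<mu> s' = 0" "\<gamma> * ?K = 0"
      by linarith+
    have "\<gamma> * (visit \<pi> s * \<pi> s $ a * pmf (P s a) s') \<le> \<gamma> * (\<delta> s * \<pi> s $ a * pmf (P s a) s')" for s a
    proof (cases "s \<in> A \<or> \<gamma> = 0 \<or> visit \<pi> s = 0 \<or> \<pi> s $ a = 0")
      case True
      then show ?thesis
        using \<delta>_nonneg nn by (auto simp: \<delta>_def)
    next
      case False
      then have pos: "0 < visit \<pi> s" "0 < \<pi> s $ a" "0 < visit \<rho> s"
        using nn(1)[of \<pi> s] nn(1)[of \<rho> s] nn(2)[of s a] by (auto simp: A_def)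
      then have "0 < \<rho> s $ a"
        by (intro dom)
      have "?K = 0"
        using 0(2) False by simp
      then have "(\<Sum>a\<in>UNIV. visit \<rho> s * \<rho> s $ a * pmf (P s a) s') = 0"
        by (subst (asm) sum_nonneg_eq_0_iff) (auto intro!: sum_nonneg mult_nonneg_nonneg nn)
      then have "visit \<rho> s * \<rho> s $ a * pmf (P s a) s' = 0"
        by (subst (asm) sum_nonneg_eq_0_iff) (auto intro!: mult_nonneg_nonneg nn)
      then have "pmf (P s a) s' = 0"
        using pos \<open>0 < \<rho> s $ a\<close> by simp
      then show ?thesis by simp
    qed
    then have "\<gamma> * (\<Sum>s\<in>UNIV. \<Sum>a\<in>UNIV. visit \<pi> s * \<pi> s $ a * pmf (P s a) s')
        \<le> \<gamma> * (\<Sum>s\<in>UNIV. \<Sum>a\<in>UNIV. \<delta> s * \<pi> s $ a * pmf (P s a) s')"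
      by (simp add: sum_distrib_left sum_mono)
    then show ?thesis
      using bellman_flowD[OF bellman_flow_state_dist[OF pol(1)], of s'] True 0(1)
      by (simp add: \<delta>_def[of s'])
  qed
  have "\<delta> s = 0"
    by (rule discounted_subinvariant_eq_0[OF pol(1) \<delta>_nonneg le])
  then show ?thesis
    using s state_dist_nonneg[of \<rho> s] by (auto simp: \<delta>_def A_def split: if_splits)
qed

end

section \<open>Relative entropy\<close>

text \<open>The value of \<^const>\<open>kl_div\<close> when it is finite; terms with \<open>p $ x = 0\<close> vanish in the reals, too.\<close>
definition kl_sum :: "real ^ 'x::finite \<Rightarrow> real ^ 'x \<Rightarrow> real" where
  "kl_sum p q = (\<Sum>x\<in>UNIV. p $ x * ln (p $ x / q $ x))"

lemma kl_div_eq: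
  assumes "p \<in> prob_simplex" "q \<in> prob_simplex"
  shows "kl_div p q = (if \<forall>x. 0 < p $ x \<longrightarrow> 0 < q $ x then ereal (kl_sum p q) else \<infinity>)"
proof (cases "\<forall>x. 0 < p $ x \<longrightarrow> 0 < q $ x")
  case True
  have "p $ x = 0 \<or> q $ x \<noteq> 0" for x
    using True[rule_format, of x] assms by (auto simp: prob_simplex_def order_less_le)
  then have "kl_div p q = (\<Sum>x\<in>UNIV. ereal (p $ x * ln (p $ x / q $ x)))"
    unfolding kl_div_def by (intro sum.cong refl) auto
  then show ?thesis
    using True by (simp add: kl_sum_def)
next
  case False
  then obtain x where "p $ x \<noteq> 0" "q $ x = 0"
    using assms by (auto simp: prob_simplex_def order_less_le)
  then have "kl_div p q = \<infinity>"
    unfolding kl_div_def by (subst sum_Pinfty) (auto intro!: exI[of _ x])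
  then show ?thesis
    using False by simp
qed

text \<open>Gibbs' inequality, from \<open>ln y \<le> y - 1\<close> applied to \<open>y = q $ x / p $ x\<close>.\<close>
lemma kl_sum_nonneg:
  assumes "p \<in> prob_simplex" "q \<in> prob_simplex" "\<And>x. 0 < p $ x \<Longrightarrow> 0 < q $ x"
  shows "0 \<le> kl_sum p q"
proof -
  have "p $ x - q $ x \<le> p $ x * ln (p $ x / q $ x)" for x
  proof (cases "p $ x = 0")
    case True
    then show ?thesis
      using assms(2) by (simp add: prob_simplex_def)
  next
    case False
    then have p: "0 < p $ x"
      using assms(1) by (simp add: prob_simplex_def order_less_le)
    then have q: "0 < q $ x"
      by (rule assms(3))
    have "ln (q $ x / p $ x) \<le> q $ x / p $ x - 1"
      using p q by (intro ln_le_minus_one) simp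
    then have "p $ x * ln (q $ x / p $ x) \<le> p $ x * (q $ x / p $ x - 1)"
      using p by (intro mult_left_mono) auto
    also have "\<dots> = q $ x - p $ x"
      using p by (simp add: field_simps)
    finally show ?thesis
      using p q by (simp add: ln_div algebra_simps)
  qed
  then have "(\<Sum>x\<in>UNIV. p $ x - q $ x) \<le> kl_sum p q"
    unfolding kl_sum_def by (rule sum_mono)
  then show ?thesis
    using assms(1,2) by (simp add: sum_subtractf prob_simplex_def)
qed

definition weighted_kl ::
  "('s::finite \<Rightarrow> real) \<Rightarrow> ('s \<Rightarrow> real ^ 'a::finite) \<Rightarrow> ('s \<Rightarrow> real ^ 'a) \<Rightarrow> real" where
  "weighted_kl d \<pi> \<rho> = (\<Sum>s\<in>UNIV. d s * kl_sum (\<pi> s) (\<rho> s))"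

text \<open>Absolute continuity of \<open>\<pi> s\<close> with respect to \<open>\<rho> s\<close> for \<open>d\<close>-almost all \<open>s\<close>: the condition under
  which the Kakade divergence is finite.\<close>
definition dominated ::
  "('s \<Rightarrow> real) \<Rightarrow> ('s \<Rightarrow> real ^ 'a::finite) \<Rightarrow> ('s \<Rightarrow> real ^ 'a) \<Rightarrow> bool" where
  "dominated d \<pi> \<rho> \<longleftrightarrow> (\<forall>s a. 0 < d s \<longrightarrow> 0 < \<pi> s $ a \<longrightarrow> 0 < \<rho> s $ a)"

lemma dominatedD: "dominated d \<pi> \<rho> \<Longrightarrow> 0 < d s \<Longrightarrow> 0 < \<pi> s $ a \<Longrightarrow> 0 < \<rho> s $ a"
  by (simp add: dominated_def)

lemma weighted_kl_term_nonneg: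
  assumes "0 \<le> d s" "\<pi> \<in> policies" "\<rho> \<in> policies" "dominated d \<pi> \<rho>"
  shows "0 \<le> d s * kl_sum (\<pi> s) (\<rho> s)"
proof (cases "d s = 0")
  case False
  with assms have "0 \<le> kl_sum (\<pi> s) (\<rho> s)"
    by (intro kl_sum_nonneg) (auto simp: policies_def dominated_def)
  with assms(1) show ?thesis
    by simp
qed simp

text \<open>Replacing \<open>d s * \<pi> s $ a\<close> by the mixture, the identity holds for each component and each pair
  \<open>(s,a)\<close> separately, by \<open>ln (\<pi>/\<rho>) + ln (\<pi>\<^sub>i/\<pi>) = ln (\<pi>\<^sub>i/\<rho>)\<close>. The logarithms cancel because a
  component of positive weight has \<open>\<pi> s $ a > 0\<close> wherever it has mass.\<close>
lemma weighted_kl_compensation: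
  assumes nonneg: "0 \<le> u" "0 \<le> v" "\<And>s. 0 \<le> d s" "\<And>s. 0 \<le> d\<^sub>1 s" "\<And>s. 0 \<le> d\<^sub>2 s"
    and pol: "\<pi> \<in> policies" "\<pi>\<^sub>1 \<in> policies" "\<pi>\<^sub>2 \<in> policies"
    and mix: "\<And>s a. d s * \<pi> s $ a = u * (d\<^sub>1 s * \<pi>\<^sub>1 s $ a) + v * (d\<^sub>2 s * \<pi>\<^sub>2 s $ a)"
    and dom: "dominated d\<^sub>1 \<pi>\<^sub>1 \<rho>" "dominated d\<^sub>2 \<pi>\<^sub>2 \<rho>"
  shows "weighted_kl d \<pi> \<rho> + u * weighted_kl d\<^sub>1 \<pi>\<^sub>1 \<pi> + v * weighted_kl d\<^sub>2 \<pi>\<^sub>2 \<pi> =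
    u * weighted_kl d\<^sub>1 \<pi>\<^sub>1 \<rho> + v * weighted_kl d\<^sub>2 \<pi>\<^sub>2 \<rho>"
proof -
  have pol_nn: "0 \<le> \<pi> s $ a" "0 \<le> \<pi>\<^sub>1 s $ a" "0 \<le> \<pi>\<^sub>2 s $ a" for s a
    using pol by (auto simp: policies_def prob_simplex_def)
  have ln_chain: "w * (e s * \<sigma> s $ a) * ln (\<pi> s $ a / \<rho> s $ a) + w * (e s * \<sigma> s $ a) * ln (\<sigma> s $ a / \<pi> s $ a)
      = w * (e s * \<sigma> s $ a) * ln (\<sigma> s $ a / \<rho> s $ a)"
    if "0 \<le> e s" "0 \<le> \<sigma> s $ a" "0 \<le> w" "w * (e s * \<sigma> s $ a) \<le> d s * \<pi> s $ a" "dominated e \<sigma> \<rho>"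
    for e \<sigma> w s a
  proof (cases "w * (e s * \<sigma> s $ a) = 0")
    case False
    then have pos: "0 < w" "0 < e s" "0 < \<sigma> s $ a"
      using that by (auto simp: order_less_le)
    then have "0 < d s * \<pi> s $ a"
      using that(4) by (smt (verit) mult_pos_pos)
    then have "0 < \<pi> s $ a" "0 < \<rho> s $ a"
      using nonneg(3)[of s] pos that(5) by (auto simp: zero_less_mult_iff dest: dominatedD)
    then show ?thesis
      using pos by (simp add: ln_div algebra_simps)
  qed auto
  have "d s * \<pi> s $ a * ln (\<pi> s $ a / \<rho> s $ a)
       + u * (d\<^sub>1 s * \<pi>\<^sub>1 s $ a) * ln (\<pi>\<^sub>1 s $ a / \<pi> s $ a)
       + v * (d\<^sub>2 s * \<pi>\<^sub>2 s $ a) * ln (\<pi>\<^sub>2 s $ a / \<pi> s $ a) =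
     u * (d\<^sub>1 s * \<pi>\<^sub>1 s $ a) * ln (\<pi>\<^sub>1 s $ a / \<rho> s $ a)
       + v * (d\<^sub>2 s * \<pi>\<^sub>2 s $ a) * ln (\<pi>\<^sub>2 s $ a / \<rho> s $ a)" for s a
  proof -
    have "u * (d\<^sub>1 s * \<pi>\<^sub>1 s $ a) \<le> d s * \<pi> s $ a" "v * (d\<^sub>2 s * \<pi>\<^sub>2 s $ a) \<le> d s * \<pi> s $ a"
      using nonneg pol_nn by (simp_all add: mix)
    from ln_chain[OF nonneg(4) pol_nn(2) nonneg(1) this(1) dom(1)]
      ln_chain[OF nonneg(5) pol_nn(3) nonneg(2) this(2) dom(2)]
    show ?thesis
      unfolding mix distrib_right by linarith
  qed
  then have "(\<Sum>s\<in>UNIV. \<Sum>a\<in>UNIV. d s * \<pi> s $ a * ln (\<pi> s $ a / \<rho> s $ a)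
       + u * (d\<^sub>1 s * \<pi>\<^sub>1 s $ a) * ln (\<pi>\<^sub>1 s $ a / \<pi> s $ a)
       + v * (d\<^sub>2 s * \<pi>\<^sub>2 s $ a) * ln (\<pi>\<^sub>2 s $ a / \<pi> s $ a)) =
     (\<Sum>s\<in>UNIV. \<Sum>a\<in>UNIV. u * (d\<^sub>1 s * \<pi>\<^sub>1 s $ a) * ln (\<pi>\<^sub>1 s $ a / \<rho> s $ a)
       + v * (d\<^sub>2 s * \<pi>\<^sub>2 s $ a) * ln (\<pi>\<^sub>2 s $ a / \<rho> s $ a))"
    by (simp only:)
  then show ?thesis
    by (simp only: weighted_kl_def kl_sum_def sum.distrib sum_distrib_left mult.assoc)
qed

section \<open>Finite values of the Kakade divergence\<close>

context discounted_mdp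
begin

lemma kakade_div_eq:
  assumes "\<pi> \<in> policies" "\<rho> \<in> policies"
  shows "kakade_div \<gamma> \<mu> P \<pi> \<rho> =
    (if dominated (visit \<pi>) \<pi> \<rho> then ereal (weighted_kl (visit \<pi>) \<pi> \<rho>) else \<infinity>)"
proof -
  let ?t = "\<lambda>s. ereal (visit \<pi> s) * kl_div (\<pi> s) (\<rho> s)"
  have kl: "kl_div (\<pi> s) (\<rho> s) =
      (if \<forall>a. 0 < \<pi> s $ a \<longrightarrow> 0 < \<rho> s $ a then ereal (kl_sum (\<pi> s) (\<rho> s)) else \<infinity>)" for s
    using assms by (intro kl_div_eq) (auto simp: policies_def)
  show ?thesis
  proof (cases "dominated (visit \<pi>) \<pi> \<rho>")
    case True
    have "?t s = ereal (visit \<pi> s * kl_sum (\<pi> s) (\<rho> s))" for s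
      using state_dist_nonneg[of \<pi> s] dominatedD[OF True, of s]
      by (cases "visit \<pi> s = 0") (auto simp: kl zero_ereal_def[symmetric])
    then show ?thesis
      using True by (simp add: kakade_div_def weighted_kl_def)
  next
    case False
    then obtain s a where "0 < visit \<pi> s" "0 < \<pi> s $ a" "\<not> 0 < \<rho> s $ a"
      by (auto simp: dominated_def)
    then have "?t s = \<infinity>"
      by (auto simp: kl)
    then have "kakade_div \<gamma> \<mu> P \<pi> \<rho> = \<infinity>"
      unfolding kakade_div_def by (subst sum_Pinfty) (auto intro!: exI[of _ s])
    with False show ?thesis by simp
  qed
qed

text \<open>Domination constrains \<open>\<rho>\<close> relative to \<open>\<sigma>\<close> only in states visited under \<open>\<rho>\<close>; this suffices, since
  \<open>\<rho>\<close> reaches all states visited under \<open>\<pi>\<close>.\<close>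
lemma dominated_trans:
  assumes pol: "\<pi> \<in> policies" "\<rho> \<in> policies"
    and dom: "dominated (visit \<pi>) \<pi> \<rho>" "dominated (visit \<rho>) \<rho> \<sigma>"
  shows "dominated (visit \<pi>) \<pi> \<sigma>"
proof -
  have "0 < visit \<rho> s" if "0 < visit \<pi> s" for s
    using dominatedD[OF dom(1)] that by (intro visited_if_actions_dominated[OF pol, of s]) blast+
  then show ?thesis
    using dom unfolding dominated_def by blast
qed

section \<open>Policies with prescribed combinations of occupancy measures\<close>

lemma product_policies_subset:
  assumes "\<And>s. Q s \<subseteq> prob_simplex" "\<pi> \<in> product_policies Q"
  shows "\<pi> \<in> policies"
  using assms by (auto simp: product_policies_def policies_def)

text \<open>The combination of two occupancy measures satisfies the flow equation, so it is the occupancy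
  measure of the policy obtained by conditioning on the state, provided that this policy exists. In
  a state whose combined weight is 0 there is nothing to condition on, and \<open>\<pi>\<^sub>1\<close> is used.\<close>
lemma occupancy_combination:
  fixes Q :: "'s \<Rightarrow> (real ^ 'a) set" and \<pi>\<^sub>1 \<pi>\<^sub>2 :: "'s \<Rightarrow> real ^ 'a"
  defines "d \<equiv> \<lambda>u v s. u * visit \<pi>\<^sub>1 s + v * visit \<pi>\<^sub>2 s"
  assumes Q: "\<And>s. Q s \<subseteq> prob_simplex"
    and \<pi>: "\<pi>\<^sub>1 \<in> product_policies Q" "\<pi>\<^sub>2 \<in> product_policies Q"
    and uv: "u + v = 1"
    and mem: "\<And>s. d u v s \<noteq> 0 \<Longrightarrow>
      (u * visit \<pi>\<^sub>1 s / d u v s) *\<^sub>R \<pi>\<^sub>1 s + (v * visit \<pi>\<^sub>2 s / d u v s) *\<^sub>R \<pi>\<^sub>2 s \<in> Q s"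
    and zero: "\<And>s a. d u v s = 0 \<Longrightarrow>
      u * (visit \<pi>\<^sub>1 s * \<pi>\<^sub>1 s $ a) + v * (visit \<pi>\<^sub>2 s * \<pi>\<^sub>2 s $ a) = 0"
  obtains \<rho> where "\<rho> \<in> product_policies Q" "\<And>s. visit \<rho> s = u * visit \<pi>\<^sub>1 s + v * visit \<pi>\<^sub>2 s"
    "\<And>s a. visit \<rho> s * \<rho> s $ a = u * (visit \<pi>\<^sub>1 s * \<pi>\<^sub>1 s $ a) + v * (visit \<pi>\<^sub>2 s * \<pi>\<^sub>2 s $ a)"
proof -
  define \<rho> where "\<rho> s = (if d u v s = 0 then \<pi>\<^sub>1 s
    else (u * visit \<pi>\<^sub>1 s / d u v s) *\<^sub>R \<pi>\<^sub>1 s + (v * visit \<pi>\<^sub>2 s / d u v s) *\<^sub>R \<pi>\<^sub>2 s)" for s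
  have \<rho>: "\<rho> \<in> product_policies Q"
    using \<pi> mem by (auto simp: \<rho>_def product_policies_def)
  have occ: "d u v s * \<rho> s $ a = u * (visit \<pi>\<^sub>1 s * \<pi>\<^sub>1 s $ a) + v * (visit \<pi>\<^sub>2 s * \<pi>\<^sub>2 s $ a)" for s a
    using zero[of s a] by (simp add: \<rho>_def field_simps)
  note pol = product_policies_subset[OF Q]
  have "bellman_flow (d u v) \<rho>"
    by (rule bellman_flow_affine_combination[OF bellman_flow_state_dist[OF pol[OF \<pi>(1)]]
          bellman_flow_state_dist[OF pol[OF \<pi>(2)]] uv]) (simp_all add: d_def occ[unfolded d_def])
  then have "visit \<rho> = d u v"
    by (rule bellman_flow_unique[OF pol[OF \<rho>] bellman_flow_state_dist[OF pol[OF \<rho>]]])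
  with occ \<rho> show thesis
    by (intro that) (auto simp: d_def)
qed

text \<open>The conditional policy of a mixture is, state by state, a convex combination, with weights that
  depend on the state. It stays in \<open>Q\<close> because \<open>Q\<close> is a product over the states.\<close>
lemma convex_mixture:
  fixes Q :: "'s \<Rightarrow> (real ^ 'a) set"
  assumes Q: "\<And>s. convex (Q s)" "\<And>s. Q s \<subseteq> prob_simplex"
    and \<pi>: "\<pi>\<^sub>1 \<in> product_policies Q" "\<pi>\<^sub>2 \<in> product_policies Q"
    and uv: "0 \<le> u" "0 \<le> v" "u + v = 1"
  obtains \<rho> where "\<rho> \<in> product_policies Q" "\<And>s. visit \<rho> s = u * visit \<pi>\<^sub>1 s + v * visit \<pi>\<^sub>2 s"
    "\<And>s a. visit \<rho> s * \<rho> s $ a = u * (visit \<pi>\<^sub>1 s * \<pi>\<^sub>1 s $ a) + v * (visit \<pi>\<^sub>2 s * \<pi>\<^sub>2 s $ a)"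
proof (rule occupancy_combination[OF Q(2) \<pi> uv(3)])
  fix s
  let ?d = "u * visit \<pi>\<^sub>1 s + v * visit \<pi>\<^sub>2 s"
  have nn: "0 \<le> u * visit \<pi>\<^sub>1 s" "0 \<le> v * visit \<pi>\<^sub>2 s"
    using uv by (simp_all add: state_dist_nonneg)
  show "(u * visit \<pi>\<^sub>1 s / ?d) *\<^sub>R \<pi>\<^sub>1 s + (v * visit \<pi>\<^sub>2 s / ?d) *\<^sub>R \<pi>\<^sub>2 s \<in> Q s" if "?d \<noteq> 0"
    using \<pi> nn that
    by (intro convexD[OF Q(1)]) (auto simp: product_policies_def add_divide_distrib[symmetric])
  show "u * (visit \<pi>\<^sub>1 s * \<pi>\<^sub>1 s $ a) + v * (visit \<pi>\<^sub>2 s * \<pi>\<^sub>2 s $ a) = 0" if "?d = 0" for a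
  proof -
    have "u * visit \<pi>\<^sub>1 s = 0" "v * visit \<pi>\<^sub>2 s = 0"
      using nn that by linarith+
    then have "u * visit \<pi>\<^sub>1 s * \<pi>\<^sub>1 s $ a = 0" "v * visit \<pi>\<^sub>2 s * \<pi>\<^sub>2 s $ a = 0"
      by simp_all
    then show ?thesis by (simp only: mult.assoc[symmetric] add_0)
  qed
qed (use that in blast)

section \<open>The Pythagorean inequality\<close>

text \<open>If \<open>\<rho> l s $ a\<close> tended to 0, the term \<open>- visit \<pi> s * \<pi> s $ a * ln (\<rho> l s $ a)\<close> would tend to
  infinity, while the remaining terms of the divergence are bounded below. Hence a bound on the
  divergence keeps \<open>\<rho> l s $ a\<close> away from 0.\<close>
lemma limit_dominates_if_kl_bounded:
  fixes \<pi> \<pi>' :: "'s \<Rightarrow> real ^ 'a" and \<rho> :: "real \<Rightarrow> 's \<Rightarrow> real ^ 'a"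
  assumes pol: "\<pi> \<in> policies" "\<And>l. 0 < l \<Longrightarrow> l < 1 \<Longrightarrow> \<rho> l \<in> policies"
    and dom: "\<And>l. 0 < l \<Longrightarrow> l < 1 \<Longrightarrow> dominated (visit \<pi>) \<pi> (\<rho> l)"
    and bound: "\<And>l. 0 < l \<Longrightarrow> l < 1 \<Longrightarrow> weighted_kl (visit \<pi>) \<pi> (\<rho> l) \<le> K"
    and lim: "((\<lambda>l. \<rho> l s $ a) \<longlongrightarrow> \<pi>' s $ a) (at_right 0)"
    and pos: "0 < visit \<pi> s" "0 < \<pi> s $ a"
  shows "0 < \<pi>' s $ a"
proof -
  define c where "c = (\<Sum>b\<in>UNIV. \<pi> s $ b * ln (\<pi> s $ b))"
  define L where "L = exp ((c - K / visit \<pi> s) / \<pi> s $ a)"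
  \<comment> \<open>The bound comes from \<open>kl_sum \<ge> c - \<pi> s $ a * ln (\<rho> l s $ a)\<close>, where \<open>c\<close> is the negative
    entropy of \<open>\<pi> s\<close>; the terms \<open>- \<pi> s $ b * ln (\<rho> l s $ b) \<ge> 0\<close> for \<open>b \<noteq> a\<close> are dropped.\<close>
  have "L \<le> \<rho> l s $ a" if l: "0 < l" "l < 1" for l
  proof -
    note polr = pol(2)[OF l] and doml = dom[OF l]
    have \<rho>_pos: "0 < \<rho> l s $ b" if "0 < \<pi> s $ b" for b
      using dominatedD[OF doml pos(1) that] .
    have \<rho>_le: "\<rho> l s $ b \<le> 1" for b
      using member_le_sum[of b UNIV "\<lambda>b. \<rho> l s $ b"] policy_nonneg[OF polr] policy_sum[OF polr] by simp
    have "\<pi> s $ b * ln (\<pi> s $ b) - (if b = a then \<pi> s $ a * ln (\<rho> l s $ a) else 0)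
        \<le> \<pi> s $ b * ln (\<pi> s $ b / \<rho> l s $ b)" for b
    proof (cases "\<pi> s $ b = 0")
      case False
      then have "0 < \<pi> s $ b"
        using policy_nonneg[OF pol(1), of s b] by simp
      moreover have "ln (\<rho> l s $ b) \<le> 0"
        using \<rho>_pos[OF calculation] \<rho>_le by simp
      ultimately show ?thesis
        using \<rho>_pos[of b] by (auto simp: ln_div right_diff_distrib mult_nonneg_nonpos)
    qed (use pos in auto)
    then have "(\<Sum>b\<in>UNIV. \<pi> s $ b * ln (\<pi> s $ b) - (if b = a then \<pi> s $ a * ln (\<rho> l s $ a) else 0))
        \<le> kl_sum (\<pi> s) (\<rho> l s)"
      unfolding kl_sum_def by (rule sum_mono)
    then have "c - \<pi> s $ a * ln (\<rho> l s $ a) \<le> kl_sum (\<pi> s) (\<rho> l s)"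
      by (simp add: sum_subtractf c_def)
    moreover have "visit \<pi> s * kl_sum (\<pi> s) (\<rho> l s) \<le> weighted_kl (visit \<pi>) \<pi> (\<rho> l)"
      unfolding weighted_kl_def
      by (rule member_le_sum[where f = "\<lambda>s. visit \<pi> s * kl_sum (\<pi> s) (\<rho> l s)"])
         (simp_all add: weighted_kl_term_nonneg state_dist_nonneg pol(1) polr doml)
    then have "kl_sum (\<pi> s) (\<rho> l s) \<le> K / visit \<pi> s"
      using bound[OF l] pos(1) by (simp add: pos_le_divide_eq mult.commute)
    ultimately have "c - K / visit \<pi> s \<le> ln (\<rho> l s $ a) * \<pi> s $ a"
      by (simp add: mult.commute)
    then have "(c - K / visit \<pi> s) / \<pi> s $ a \<le> ln (\<rho> l s $ a)"
      using pos(2) by (simp add: pos_divide_le_eq)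
    then show ?thesis
      unfolding L_def using \<rho>_pos[OF pos(2)] by (simp add: ln_ge_iff)
  qed
  then have "eventually (\<lambda>l. L \<le> \<rho> l s $ a) (at_right 0)"
    by (intro eventually_at_rightI[of 0 1]) auto
  then have "L \<le> \<pi>' s $ a"
    by (intro tendsto_lowerbound[OF lim]) auto
  moreover have "0 < L"
    by (simp add: L_def)
  ultimately show ?thesis by linarith
qed

lemma tendsto_weighted_kl:
  assumes "\<And>s. 0 \<le> d s" "\<pi> \<in> policies" "dominated d \<pi> \<pi>'"
    and "\<And>s a. 0 < d s \<Longrightarrow> ((\<lambda>l. \<rho> l s $ a) \<longlongrightarrow> \<pi>' s $ a) F"
  shows "((\<lambda>l. weighted_kl d \<pi> (\<rho> l)) \<longlongrightarrow> weighted_kl d \<pi> \<pi>') F"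
  unfolding weighted_kl_def
proof (rule tendsto_sum)
  fix s
  show "((\<lambda>l. d s * kl_sum (\<pi> s) (\<rho> l s)) \<longlongrightarrow> d s * kl_sum (\<pi> s) (\<pi>' s)) F"
  proof (cases "d s = 0")
    case False
    then have d: "0 < d s"
      using assms(1)[of s] by simp
    have "((\<lambda>l. \<pi> s $ a * ln (\<pi> s $ a / \<rho> l s $ a)) \<longlongrightarrow> \<pi> s $ a * ln (\<pi> s $ a / \<pi>' s $ a)) F" for a
    proof (cases "\<pi> s $ a = 0")
      case False
      then have p: "0 < \<pi> s $ a"
        using policy_nonneg[OF assms(2), of s a] by simp
      then have "0 < \<pi>' s $ a"
        by (rule dominatedD[OF assms(3) d])
      with p show ?thesis
        by (intro tendsto_intros assms(4) d) auto
    qed simp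
    then have "((\<lambda>l. kl_sum (\<pi> s) (\<rho> l s)) \<longlongrightarrow> kl_sum (\<pi> s) (\<pi>' s)) F"
      unfolding kl_sum_def by (rule tendsto_sum)
    then show ?thesis
      by (rule tendsto_mult[OF tendsto_const])
  qed simp
qed

text \<open>The difference quotient of the divergence along the segment from \<open>\<pi>'\<close> to \<open>\<pi>\<close> is bounded below by
  0 because \<open>\<pi>'\<close> is a minimiser. By the compensation identity this yields a bound on
  \<open>D(\<pi>,\<rho> l)\<close> that does not depend on \<open>l\<close>, from which first the inclusion of supports and then
  the inequality follow in the limit.\<close>
lemma kakade_pythagorean_inequality:
  fixes Q :: "'s \<Rightarrow> (real ^ 'a) set"
  assumes Q: "\<And>s. convex (Q s)" "\<And>s. Q s \<subseteq> prob_simplex"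
    and \<pi>\<^sub>0: "\<pi>\<^sub>0 \<in> policies" and \<pi>': "\<pi>' \<in> product_policies Q" and \<pi>: "\<pi> \<in> product_policies Q"
    and min: "\<forall>\<sigma>\<in>product_policies Q. kakade_div \<gamma> \<mu> P \<pi>' \<pi>\<^sub>0 \<le> kakade_div \<gamma> \<mu> P \<sigma> \<pi>\<^sub>0"
    and dom: "dominated (visit \<pi>) \<pi> \<pi>\<^sub>0"
  shows "dominated (visit \<pi>') \<pi>' \<pi>\<^sub>0" "\<And>s. 0 < visit \<pi> s \<Longrightarrow> 0 < visit \<pi>' s"
    "dominated (visit \<pi>) \<pi> \<pi>'"
    "weighted_kl (visit \<pi>) \<pi> \<pi>' + weighted_kl (visit \<pi>') \<pi>' \<pi>\<^sub>0 \<le> weighted_kl (visit \<pi>) \<pi> \<pi>\<^sub>0"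
proof -
  note pol = product_policies_subset[where Q = Q, OF Q(2)]
  note div_eq = kakade_div_eq[OF pol \<pi>\<^sub>0]
  show dom': "dominated (visit \<pi>') \<pi>' \<pi>\<^sub>0"
    using min[rule_format, OF \<pi>] dom by (auto simp: div_eq[OF \<pi>] div_eq[OF \<pi>'] split: if_splits)
  have "\<exists>\<rho>. \<rho> \<in> product_policies Q \<and> (\<forall>s. visit \<rho> s = (1 - l) * visit \<pi>' s + l * visit \<pi> s) \<and>
      (\<forall>s a. visit \<rho> s * \<rho> s $ a = (1 - l) * (visit \<pi>' s * \<pi>' s $ a) + l * (visit \<pi> s * \<pi> s $ a))"
    if "0 < l \<and> l < 1" for l
  proof -
    have "0 \<le> 1 - l" "0 \<le> l" "1 - l + l = 1"
      using that by auto
    then obtain \<sigma> where "\<sigma> \<in> product_policies Q"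
      "\<And>s. visit \<sigma> s = (1 - l) * visit \<pi>' s + l * visit \<pi> s"
      "\<And>s a. visit \<sigma> s * \<sigma> s $ a = (1 - l) * (visit \<pi>' s * \<pi>' s $ a) + l * (visit \<pi> s * \<pi> s $ a)"
      using convex_mixture[OF Q \<pi>' \<pi>] by metis
    then show ?thesis
      by blast
  qed
  then obtain \<rho> where \<rho>: "\<And>l. 0 < l \<Longrightarrow> l < 1 \<Longrightarrow> \<rho> l \<in> product_policies Q"
    and visit_\<rho>: "\<And>l s. 0 < l \<Longrightarrow> l < 1 \<Longrightarrow> visit (\<rho> l) s = (1 - l) * visit \<pi>' s + l * visit \<pi> s"
    and occ_\<rho>: "\<And>l s a. 0 < l \<Longrightarrow> l < 1 \<Longrightarrow>
      visit (\<rho> l) s * \<rho> l s $ a = (1 - l) * (visit \<pi>' s * \<pi>' s $ a) + l * (visit \<pi> s * \<pi> s $ a)"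
    by metis
  define K where "K = weighted_kl (visit \<pi>) \<pi> \<pi>\<^sub>0 - weighted_kl (visit \<pi>') \<pi>' \<pi>\<^sub>0"
  have step: "dominated (visit \<pi>) \<pi> (\<rho> l) \<and> weighted_kl (visit \<pi>) \<pi> (\<rho> l) \<le> K"
    if l: "0 < l" "l < 1" for l
  proof -
    note nn = state_dist_nonneg policy_nonneg[OF pol[OF \<pi>]] policy_nonneg[OF pol[OF \<pi>']]
      policy_nonneg[OF pol[OF \<rho>[OF l]]]
    have pos_iff: "0 < visit (\<rho> l) s \<and> 0 < \<rho> l s $ a \<longleftrightarrow>
      0 < visit \<pi>' s \<and> 0 < \<pi>' s $ a \<or> 0 < visit \<pi> s \<and> 0 < \<pi> s $ a" for s a
    proof -
      have iff: "0 < visit \<sigma> s \<and> 0 < \<sigma> s $ a \<longleftrightarrow> 0 < visit \<sigma> s * \<sigma> s $ a" if "0 \<le> \<sigma> s $ a" for \<sigma> :: "'s \<Rightarrow> real ^ 'a"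
        using nn(1)[of \<sigma> s] that by (auto simp: zero_less_mult_iff)
      have pos_mix: "0 < (1 - l) * x + l * y \<longleftrightarrow> 0 < x \<or> 0 < y" if "0 \<le> x" "0 \<le> y" for x y
      proof -
        have "0 \<le> (1 - l) * x" "0 \<le> l * y"
          using that l by simp_all
        then have "0 < (1 - l) * x + l * y \<longleftrightarrow> 0 < (1 - l) * x \<or> 0 < l * y"
          by linarith
        then show ?thesis
          using l by (simp add: zero_less_mult_iff)
      qed
      have "0 < visit (\<rho> l) s * \<rho> l s $ a \<longleftrightarrow> 0 < visit \<pi>' s * \<pi>' s $ a \<or> 0 < visit \<pi> s * \<pi> s $ a"
        unfolding occ_\<rho>[OF l] by (rule pos_mix) (simp_all add: nn)
      then show ?thesis
        by (simp only: iff[of \<pi>, OF nn(2)] iff[of \<pi>', OF nn(3)] iff[of "\<rho> l", OF nn(4)])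
    qed
    have d1: "dominated (visit \<pi>) \<pi> (\<rho> l)" "dominated (visit \<pi>') \<pi>' (\<rho> l)" "dominated (visit (\<rho> l)) (\<rho> l) \<pi>\<^sub>0"
      using pos_iff dom dom' unfolding dominated_def by blast+
    have "weighted_kl (visit (\<rho> l)) (\<rho> l) \<pi>\<^sub>0 + (1 - l) * weighted_kl (visit \<pi>') \<pi>' (\<rho> l)
        + l * weighted_kl (visit \<pi>) \<pi> (\<rho> l) =
      (1 - l) * weighted_kl (visit \<pi>') \<pi>' \<pi>\<^sub>0 + l * weighted_kl (visit \<pi>) \<pi> \<pi>\<^sub>0"
      using l by (intro weighted_kl_compensation pol \<rho> \<pi> \<pi>' occ_\<rho> dom dom' state_dist_nonneg) auto
    moreover have "weighted_kl (visit \<pi>') \<pi>' \<pi>\<^sub>0 \<le> weighted_kl (visit (\<rho> l)) (\<rho> l) \<pi>\<^sub>0"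
      using min[rule_format, OF \<rho>[OF l]] d1 dom' by (simp add: div_eq[OF \<rho>[OF l]] div_eq[OF \<pi>'])
    moreover have "0 \<le> (1 - l) * weighted_kl (visit \<pi>') \<pi>' (\<rho> l)"
      unfolding weighted_kl_def using l
      by (intro mult_nonneg_nonneg sum_nonneg weighted_kl_term_nonneg pol \<pi>' \<rho> d1 state_dist_nonneg) auto
    ultimately have "l * weighted_kl (visit \<pi>) \<pi> (\<rho> l) \<le> l * K"
      unfolding K_def by (simp add: algebra_simps)
    then show ?thesis
      using l d1 by simp
  qed
  \<comment> \<open>In states visited only under \<open>\<pi>\<close> the mixture agrees with \<open>\<pi>\<close> for every \<open>l\<close>, so the
    limit can be claimed to be \<open>\<pi>'\<close> only in states visited under \<open>\<pi>'\<close>.\<close>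
  have lim: "((\<lambda>l. \<rho> l s $ a) \<longlongrightarrow> \<pi>' s $ a) (at_right 0)" if s: "0 < visit \<pi>' s" for s a
  proof (rule Lim_transform_eventually)
    let ?f = "\<lambda>l. ((1 - l) * (visit \<pi>' s * \<pi>' s $ a) + l * (visit \<pi> s * \<pi> s $ a)) /
      ((1 - l) * visit \<pi>' s + l * visit \<pi> s)"
    have "(?f \<longlongrightarrow> ((1 - 0) * (visit \<pi>' s * \<pi>' s $ a) + 0 * (visit \<pi> s * \<pi> s $ a)) /
      ((1 - 0) * visit \<pi>' s + 0 * visit \<pi> s)) (at_right 0)"
      using s by (intro tendsto_intros) auto
    then show "(?f \<longlongrightarrow> \<pi>' s $ a) (at_right 0)"
      using s by simp
    have "?f l = \<rho> l s $ a" if "0 < l" "l < 1" for l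
    proof -
      have "0 < (1 - l) * visit \<pi>' s + l * visit \<pi> s"
        using s that state_dist_nonneg[of \<pi> s] by (simp add: add_pos_nonneg)
      then show ?thesis
        using occ_\<rho>[OF that, of s a] by (simp add: visit_\<rho>[OF that] field_simps)
    qed
    then show "eventually (\<lambda>l. ?f l = \<rho> l s $ a) (at_right 0)"
      by (intro eventually_at_rightI[of 0 1]) auto
  qed
  have sup: "0 < \<pi>' s $ a" if "0 < visit \<pi> s" "0 < visit \<pi>' s" "0 < \<pi> s $ a" for s a
    using step that by (intro limit_dominates_if_kl_bounded[of \<pi> \<rho> K s a \<pi>'] pol \<pi> \<rho> lim) auto
  show vis: "0 < visit \<pi>' s" if "0 < visit \<pi> s" for s
    by (rule visited_if_actions_dominated[OF pol[OF \<pi>] pol[OF \<pi>'] sup that])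
  show dom2: "dominated (visit \<pi>) \<pi> \<pi>'"
    unfolding dominated_def using sup vis by blast
  have "((\<lambda>l. weighted_kl (visit \<pi>) \<pi> (\<rho> l)) \<longlongrightarrow> weighted_kl (visit \<pi>) \<pi> \<pi>') (at_right 0)"
    by (intro tendsto_weighted_kl state_dist_nonneg pol \<pi> dom2 lim vis)
  moreover have "eventually (\<lambda>l. weighted_kl (visit \<pi>) \<pi> (\<rho> l) \<le> K) (at_right 0)"
    using step by (intro eventually_at_rightI[of 0 1]) auto
  ultimately have "weighted_kl (visit \<pi>) \<pi> \<pi>' \<le> K"
    by (rule tendsto_upperbound) simp
  then show "weighted_kl (visit \<pi>) \<pi> \<pi>' + weighted_kl (visit \<pi>') \<pi>' \<pi>\<^sub>0 \<le> weighted_kl (visit \<pi>) \<pi> \<pi>\<^sub>0"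
    by (simp add: K_def)
qed

section \<open>The Pythagorean identity for affine constraints\<close>

text \<open>By the inclusion of supports, \<open>\<pi>'\<close> lies in the relative interior of a segment from \<open>\<pi>\<close> to some
  \<open>\<rho>\<close> in the product set, at the level of occupancy measures. The inequality for \<open>\<rho>\<close> then becomes the
  reverse inequality for \<open>\<pi>\<close>.\<close>
lemma kakade_pythagorean_equality:
  fixes Q :: "'s \<Rightarrow> (real ^ 'a) set"
  assumes Q: "\<And>s. affine (L s)" "\<And>s. Q s = prob_simplex \<inter> L s" "\<And>s. convex (Q s)"
    and \<pi>\<^sub>0: "\<pi>\<^sub>0 \<in> policies" and \<pi>': "\<pi>' \<in> product_policies Q" and \<pi>: "\<pi> \<in> product_policies Q"
    and min: "\<forall>\<sigma>\<in>product_policies Q. kakade_div \<gamma> \<mu> P \<pi>' \<pi>\<^sub>0 \<le> kakade_div \<gamma> \<mu> P \<sigma> \<pi>\<^sub>0"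
    and dom: "dominated (visit \<pi>) \<pi> \<pi>\<^sub>0"
  shows "weighted_kl (visit \<pi>) \<pi> \<pi>\<^sub>0 = weighted_kl (visit \<pi>) \<pi> \<pi>' + weighted_kl (visit \<pi>') \<pi>' \<pi>\<^sub>0"
proof (rule antisym)
  have Qsub: "Q s \<subseteq> prob_simplex" for s
    using Q(2) by auto
  note ineq = kakade_pythagorean_inequality[where Q = Q, OF Q(3) Qsub \<pi>\<^sub>0 \<pi>' _ min]
  note pol = product_policies_subset[where Q = Q, OF Qsub]
  note dom' = ineq(1)[OF \<pi> dom] and vis = ineq(2)[OF \<pi> dom] and dom2 = ineq(3)[OF \<pi> dom]
  show "weighted_kl (visit \<pi>) \<pi> \<pi>' + weighted_kl (visit \<pi>') \<pi>' \<pi>\<^sub>0 \<le> weighted_kl (visit \<pi>) \<pi> \<pi>\<^sub>0"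
    by (rule ineq(4)[OF \<pi> dom])
  define x where "x s a = visit \<pi> s * \<pi> s $ a" for s a
  define x' where "x' s a = visit \<pi>' s * \<pi>' s $ a" for s a
  have nn: "0 \<le> x s a" "0 \<le> x' s a" for s a
    by (simp_all add: x_def x'_def state_dist_nonneg policy_nonneg pol \<pi> \<pi>')
  have "eventually (\<lambda>l. l * x s a \<le> x' s a) (at_right 0)" for s a
  proof (cases "x s a = 0")
    case False
    then have "0 < visit \<pi> s" "0 < \<pi> s $ a"
      using state_dist_nonneg[of \<pi> s] policy_nonneg[OF pol[OF \<pi>], of s a] by (auto simp: x_def)
    then have "0 < x' s a"
      using vis dominatedD[OF dom2] by (simp add: x'_def)
    moreover have "((\<lambda>l. l * x s a) \<longlongrightarrow> 0 * x s a) (at_right 0)"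
      by (intro tendsto_intros)
    ultimately have "eventually (\<lambda>l. l * x s a < x' s a) (at_right 0)"
      by (intro order_tendstoD(2)) auto
    then show ?thesis
      by eventually_elim simp
  qed (simp add: nn)
  then have "eventually (\<lambda>l. \<forall>s a. l * x s a \<le> x' s a) (at_right 0)"
    by (intro eventually_all_finite)
  moreover have "eventually (\<lambda>l. 0 < l \<and> l < (1::real)) (at_right 0)"
    by (intro eventually_at_rightI[of 0 1]) auto
  ultimately have "eventually (\<lambda>l. (\<forall>s a. l * x s a \<le> x' s a) \<and> 0 < l \<and> l < 1) (at_right 0)"
    by eventually_elim simp
  then obtain l where l: "0 < l" "l < 1" and le: "\<And>s a. l * x s a \<le> x' s a"
    by (auto dest!: eventually_happens)
  \<comment> \<open>The weights for which \<open>\<pi>'\<close> is the mixture \<open>(1 - l) \<rho> + l \<pi>\<close>.\<close>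
  define u v where "u = 1 / (1 - l)" and "v = - l / (1 - l)"
  have uv: "u + v = 1"
    using l by (simp add: u_def v_def field_simps)
  have occ_eq: "u * y' + v * y = (y' - l * y) / (1 - l)" for y y'
    by (simp add: u_def v_def diff_divide_distrib)
  have occ_nn: "0 \<le> u * x' s a + v * x s a" for s a
    using le[of s a] l by (simp add: occ_eq)
  have sum_x: "(\<Sum>a\<in>UNIV. u * x' s a + v * x s a) = u * visit \<pi>' s + v * visit \<pi> s" for s
    using policy_sum[OF pol[OF \<pi>]] policy_sum[OF pol[OF \<pi>']]
    by (simp add: x_def x'_def sum.distrib sum_distrib_left[symmetric])
  obtain \<rho> where \<rho>: "\<rho> \<in> product_policies Q"
    and visit_\<rho>: "\<And>s. visit \<rho> s = u * visit \<pi>' s + v * visit \<pi> s"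
    and occ_\<rho>: "\<And>s a. visit \<rho> s * \<rho> s $ a = u * (visit \<pi>' s * \<pi>' s $ a) + v * (visit \<pi> s * \<pi> s $ a)"
  proof (rule occupancy_combination[OF Qsub \<pi>' \<pi> uv])
    fix s
    let ?d = "u * visit \<pi>' s + v * visit \<pi> s"
    have d_nn: "0 \<le> ?d"
      unfolding sum_x[symmetric] by (intro sum_nonneg occ_nn)
    show "u * (visit \<pi>' s * \<pi>' s $ a) + v * (visit \<pi> s * \<pi> s $ a) = 0" if "?d = 0" for a
      using that occ_nn[of s] unfolding sum_x[symmetric]
      by (subst (asm) sum_nonneg_eq_0_iff) (auto simp: x_def x'_def)
    show "(u * visit \<pi>' s / ?d) *\<^sub>R \<pi>' s + (v * visit \<pi> s / ?d) *\<^sub>R \<pi> s \<in> Q s" (is "?q \<in> _") if "?d \<noteq> 0"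
    proof -
      have one: "u * visit \<pi>' s / ?d + v * visit \<pi> s / ?d = 1"
        using that by (simp add: add_divide_distrib[symmetric])
      have "\<pi>' s \<in> L s" "\<pi> s \<in> L s"
        using \<pi> \<pi>' Q(2) by (auto simp: product_policies_def)
      then have "?q \<in> L s"
        using Q(1)[of s] one unfolding affine_def by blast
      moreover have "?q $ a = (u * x' s a + v * x s a) / ?d" for a
        by (simp add: x_def x'_def add_divide_distrib)
      then have "?q \<in> prob_simplex"
        using that d_nn occ_nn by (simp add: prob_simplex_def sum_divide_distrib[symmetric] sum_x)
      ultimately show ?thesis
        using Q(2) by simp
    qed
  qed (rule that)
  have mix: "visit \<pi>' s * \<pi>' s $ a = (1 - l) * (visit \<rho> s * \<rho> s $ a) + l * (visit \<pi> s * \<pi> s $ a)" for s a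
    unfolding occ_\<rho> occ_eq using l by simp
  have dom\<rho>: "dominated (visit \<rho>) \<rho> \<pi>\<^sub>0"
    unfolding dominated_def
  proof (intro allI impI)
    fix s a
    assume "0 < visit \<rho> s" "0 < \<rho> s $ a"
    then have "0 < (1 - l) * (visit \<rho> s * \<rho> s $ a)"
      using l by simp
    moreover have "0 \<le> l * (visit \<pi> s * \<pi> s $ a)"
      using l nn(1)[of s a] by (simp add: x_def)
    ultimately have "0 < visit \<pi>' s * \<pi>' s $ a"
      unfolding mix by linarith
    then show "0 < \<pi>\<^sub>0 s $ a"
      using state_dist_nonneg[of \<pi>' s] dominatedD[OF dom'] by (auto simp: zero_less_mult_iff)
  qed
  have "weighted_kl (visit \<pi>') \<pi>' \<pi>\<^sub>0 + (1 - l) * weighted_kl (visit \<rho>) \<rho> \<pi>' + l * weighted_kl (visit \<pi>) \<pi> \<pi>' =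
      (1 - l) * weighted_kl (visit \<rho>) \<rho> \<pi>\<^sub>0 + l * weighted_kl (visit \<pi>) \<pi> \<pi>\<^sub>0"
    using l by (intro weighted_kl_compensation state_dist_nonneg pol \<pi> \<pi>' \<rho> mix dom dom\<rho>) auto
  moreover have "(1 - l) * (weighted_kl (visit \<rho>) \<rho> \<pi>' + weighted_kl (visit \<pi>') \<pi>' \<pi>\<^sub>0)
      \<le> (1 - l) * weighted_kl (visit \<rho>) \<rho> \<pi>\<^sub>0"
    using l ineq(4)[OF \<rho> dom\<rho>] by simp
  ultimately have "l * weighted_kl (visit \<pi>) \<pi> \<pi>\<^sub>0 \<le>
      l * (weighted_kl (visit \<pi>) \<pi> \<pi>' + weighted_kl (visit \<pi>') \<pi>' \<pi>\<^sub>0)"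
    by (simp add: algebra_simps)
  then show "weighted_kl (visit \<pi>) \<pi> \<pi>\<^sub>0 \<le> weighted_kl (visit \<pi>) \<pi> \<pi>' + weighted_kl (visit \<pi>') \<pi>' \<pi>\<^sub>0"
    using l by simp
qed

end

section \<open>The Pythagorean theorem for Kakade projections\<close>

theorem theorem2p7:
  fixes \<gamma> :: real
    and \<mu> :: "'s::finite pmf"
    and P :: "'s \<Rightarrow> 'a::finite \<Rightarrow> 's pmf"
    and Q :: "'s \<Rightarrow> (real ^ 'a) set"
    and \<pi>\<^sub>0 \<pi>' :: "'s \<Rightarrow> real ^ 'a"
  assumes "0 \<le> \<gamma>" and "\<gamma> < 1"
    and "\<And>s. polytope (Q s)" and "\<And>s. Q s \<subseteq> prob_simplex"
    and "\<pi>\<^sub>0 \<in> policies"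
    and "is_kakade_projection \<gamma> \<mu> P (product_policies Q) \<pi>\<^sub>0 \<pi>'"
  shows "(\<forall>\<pi>\<in>product_policies Q.
            kakade_div \<gamma> \<mu> P \<pi> \<pi>\<^sub>0 \<ge> kakade_div \<gamma> \<mu> P \<pi> \<pi>' + kakade_div \<gamma> \<mu> P \<pi>' \<pi>\<^sub>0) \<and>
         ((\<exists>\<L>. \<forall>s. affine (\<L> s) \<and> Q s = prob_simplex \<inter> \<L> s) \<longrightarrow>
          (\<forall>\<pi>\<in>product_policies Q.
            kakade_div \<gamma> \<mu> P \<pi> \<pi>\<^sub>0 = kakade_div \<gamma> \<mu> P \<pi> \<pi>' + kakade_div \<gamma> \<mu> P \<pi>' \<pi>\<^sub>0))"
proof (intro conjI impI ballI)
  interpret discounted_mdp \<gamma> \<mu> P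
    by standard (rule assms)+
  note \<pi>\<^sub>0 = assms(5)
  have conv: "convex (Q s)" for s
    by (intro polytope_imp_convex assms)
  have \<pi>': "\<pi>' \<in> product_policies Q"
    and min: "\<forall>\<sigma>\<in>product_policies Q. kakade_div \<gamma> \<mu> P \<pi>' \<pi>\<^sub>0 \<le> kakade_div \<gamma> \<mu> P \<sigma> \<pi>\<^sub>0"
    using assms(6) by (auto simp: is_kakade_projection_def is_arg_min_linorder)
  note pol = product_policies_subset[where Q = Q, OF assms(4)]
  note div_eq = kakade_div_eq[OF pol pol] kakade_div_eq[OF pol \<pi>\<^sub>0]
  fix \<pi>
  assume \<pi>: "\<pi> \<in> product_policies Q"
  note ineq = kakade_pythagorean_inequality[where Q = Q, OF conv assms(4) \<pi>\<^sub>0 \<pi>' \<pi> min]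
  show "kakade_div \<gamma> \<mu> P \<pi> \<pi>' + kakade_div \<gamma> \<mu> P \<pi>' \<pi>\<^sub>0 \<le> kakade_div \<gamma> \<mu> P \<pi> \<pi>\<^sub>0"
  proof (cases "dominated (visit \<pi>) \<pi> \<pi>\<^sub>0")
    case True
    from ineq[OF True] True show ?thesis
      by (simp add: div_eq \<pi> \<pi>')
  next
    case False
    then show ?thesis
      by (simp add: div_eq(2) \<pi>)
  qed
  assume "\<exists>\<L>. \<forall>s. affine (\<L> s) \<and> Q s = prob_simplex \<inter> \<L> s"
  then obtain L where L: "\<And>s. affine (L s)" "\<And>s. Q s = prob_simplex \<inter> L s"
    by blast
  show "kakade_div \<gamma> \<mu> P \<pi> \<pi>\<^sub>0 = kakade_div \<gamma> \<mu> P \<pi> \<pi>' + kakade_div \<gamma> \<mu> P \<pi>' \<pi>\<^sub>0"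
  proof (cases "dominated (visit \<pi>) \<pi> \<pi>\<^sub>0")
    case True
    from ineq[OF True] True kakade_pythagorean_equality[where Q = Q, OF L conv \<pi>\<^sub>0 \<pi>' \<pi> min True] show ?thesis
      by (simp add: div_eq \<pi> \<pi>')
  next
    case False
    then have "\<not> (dominated (visit \<pi>) \<pi> \<pi>' \<and> dominated (visit \<pi>') \<pi>' \<pi>\<^sub>0)"
      using dominated_trans[OF pol[OF \<pi>] pol[OF \<pi>']] by blast
    with False show ?thesis
      by (auto simp: div_eq \<pi> \<pi>')
  qed
qed

end
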